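(* Let $(X,\tau,\mathcal{I})$ be an ideal topological space, let $(Y,\sigma)$ be a topological space, and let $f\colon (X,\tau,\mathcal{I})\to(Y,\sigma)$ be a function. Then the following conditions are equivalent: (1) $f$ is $\mathcal{I}$-continuous. (2) $f$ is pre-$\mathcal{I}$-continuous and $\star$-$\mathcal{I}$-continuous.
   Context: An ideal on a set $X$ is a nonempty collection $\mathcal{I}$ of subsets of $X$ such that (a) $A\in\mathcal{I}$ and $B\subseteq A$ imply $B\in\mathcal{I}$, and (b) $A,B\in\mathcal{I}$ imply $A\cup B\in\mathcal{I}$. An ideal topological space $(X,\tau,\mathcal{I})$ is a topological space $(X,\tau)$ with an ideal $\mathcal{I}$ on $X$. For $A\subseteq X$, the local function of $A$ is $A^{*}=\{x\in X : U\cap A\notin\mathcal{I}\text{ for every }U\in\tau\text{ with }x\in U\}$, and $\mathrm{Cl}^{*}(A)=A\cup A^{*}$. $\mathrm{Int}$ denotes interior with respect to $\tau$. A set $A\subseteq X$ is $\mathcal{I}$-open if $A\subseteq\mathrm{Int}(A^{*})$; pre-$\mathcal{I}$-open if $A\subseteq\mathrm{Int}(\mathrm{Cl}^{*}(A))$; $\star$-dense-in-itself if $A\subseteq A^{*}$. A function $f\colon(X,\tau,\mathcal{I})\to(Y,\sigma)$ is $\mathcal{I}$-continuous (resp. pre-$\mathcal{I}$-continuous, $\star$-$\mathcal{I}$-continuous) if $f^{-1}(V)$ is $\mathcal{I}$-open (resp. pre-$\mathcal{I}$-open, $\star$-dense-in-itself) for every $V\in\sigma$. *)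

theory Defs
  imports "HOL-Analysis.Abstract_Topology"
begin

definition set_ideal_on :: "'a set \<Rightarrow> 'a set set \<Rightarrow> bool" where
  "set_ideal_on S \<I> \<longleftrightarrow>
     \<I> \<subseteq> Pow S \<and> \<I> \<noteq> {} \<and>
     (\<forall>A B. A \<in> \<I> \<and> B \<subseteq> A \<longrightarrow> B \<in> \<I>) \<and>
     (\<forall>A B. A \<in> \<I> \<and> B \<in> \<I> \<longrightarrow> A \<union> B \<in> \<I>)"

text \<open>The underlying set of an ideal topological space is \<open>topspace X\<close>. The ideal need not
  be proper.\<close>

definition ideal_topological_space :: "'a topology \<Rightarrow> 'a set set \<Rightarrow> bool" where
  "ideal_topological_space X \<I> \<longleftrightarrow> set_ideal_on (topspace X) \<I>"

definition local_function :: "'a topology \<Rightarrow> 'a set set \<Rightarrow> 'a set \<Rightarrow> 'a set" where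
  "local_function X \<I> A =
     {x \<in> topspace X. \<forall>U. openin X U \<and> x \<in> U \<longrightarrow> U \<inter> A \<notin> \<I>}"

definition star_closure :: "'a topology \<Rightarrow> 'a set set \<Rightarrow> 'a set \<Rightarrow> 'a set" where
  "star_closure X \<I> A = A \<union> local_function X \<I> A"

definition I_open :: "'a topology \<Rightarrow> 'a set set \<Rightarrow> 'a set \<Rightarrow> bool" where
  "I_open X \<I> A \<longleftrightarrow>
     A \<subseteq> topspace X \<and> A \<subseteq> X interior_of (local_function X \<I> A)"

definition pre_I_open :: "'a topology \<Rightarrow> 'a set set \<Rightarrow> 'a set \<Rightarrow> bool" where
  "pre_I_open X \<I> A \<longleftrightarrow>
     A \<subseteq> topspace X \<and> A \<subseteq> X interior_of (star_closure X \<I> A)"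

definition star_dense_in_itself :: "'a topology \<Rightarrow> 'a set set \<Rightarrow> 'a set \<Rightarrow> bool" where
  "star_dense_in_itself X \<I> A \<longleftrightarrow>
     A \<subseteq> topspace X \<and> A \<subseteq> local_function X \<I> A"

text \<open>A function from \<open>X\<close> to \<open>Y\<close> is an HOL function mapping \<open>topspace X\<close> into \<open>topspace Y\<close>, as
  for \<^const>\<open>continuous_map\<close>; its values elsewhere are irrelevant, so preimages are taken within
  \<open>topspace X\<close>.\<close>

definition I_continuous_map ::
    "'a topology \<Rightarrow> 'a set set \<Rightarrow> 'b topology \<Rightarrow> ('a \<Rightarrow> 'b) \<Rightarrow> bool" where
  "I_continuous_map X \<I> Y f \<longleftrightarrow>
     f \<in> topspace X \<rightarrow> topspace Y \<and>
     (\<forall>V. openin Y V \<longrightarrow> I_open X \<I> {x \<in> topspace X. f x \<in> V})"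

definition pre_I_continuous_map ::
    "'a topology \<Rightarrow> 'a set set \<Rightarrow> 'b topology \<Rightarrow> ('a \<Rightarrow> 'b) \<Rightarrow> bool" where
  "pre_I_continuous_map X \<I> Y f \<longleftrightarrow>
     f \<in> topspace X \<rightarrow> topspace Y \<and>
     (\<forall>V. openin Y V \<longrightarrow> pre_I_open X \<I> {x \<in> topspace X. f x \<in> V})"

definition star_I_continuous_map ::
    "'a topology \<Rightarrow> 'a set set \<Rightarrow> 'b topology \<Rightarrow> ('a \<Rightarrow> 'b) \<Rightarrow> bool" where
  "star_I_continuous_map X \<I> Y f \<longleftrightarrow>
     f \<in> topspace X \<rightarrow> topspace Y \<and>
     (\<forall>V. openin Y V \<longrightarrow> star_dense_in_itself X \<I> {x \<in> topspace X. f x \<in> V})"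

end

theory Submission
  imports Defs
begin

text \<open>The equivalence already holds for each single set \<open>A\<close>, and continuity
  applies it to preimages. If \<open>A\<close> lies in its local function, adjoining
  \<open>A\<close> adds nothing, so \<open>I_open\<close> and \<open>pre_I_open\<close> ask for the
  same inclusion. Conversely, \<open>I_open\<close> forces \<open>A\<close> into its local function,
  since an interior lies in the set itself.\<close>

lemma star_closure_eq_local_function:
  assumes "star_dense_in_itself X \<I> A"
  shows "star_closure X \<I> A = local_function X \<I> A"
  using assms by (auto simp: star_closure_def star_dense_in_itself_def)

lemma I_open_imp_star_dense_in_itself:
  assumes "I_open X \<I> A"
  shows "star_dense_in_itself X \<I> A"
  using assms interior_of_subset[of X "local_function X \<I> A"]
  by (auto simp: I_open_def star_dense_in_itself_def)

text \<open>Either side makes \<open>A\<close> star-dense-in-itself, so \<open>star_closure\<close>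
  and \<open>local_function\<close> are interchangeable under the interior.\<close>

lemma I_open_iff_pre_I_open_and_star_dense_in_itself:
  "I_open X \<I> A \<longleftrightarrow> pre_I_open X \<I> A \<and> star_dense_in_itself X \<I> A"
  using I_open_imp_star_dense_in_itself[of X \<I> A] star_closure_eq_local_function[of X \<I> A]
  by (auto simp: I_open_def pre_I_open_def)

theorem theorem3p11:
  fixes X :: "'a topology" and \<I> :: "'a set set" and Y :: "'b topology" and f :: "'a \<Rightarrow> 'b"
  assumes "ideal_topological_space X \<I>"
    and "f \<in> topspace X \<rightarrow> topspace Y"
  shows "I_continuous_map X \<I> Y f \<longleftrightarrow>
         pre_I_continuous_map X \<I> Y f \<and> star_I_continuous_map X \<I> Y f"
  unfolding I_continuous_map_def pre_I_continuous_map_def star_I_continuous_map_def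
    I_open_iff_pre_I_open_and_star_dense_in_itself
  \<comment> \<open>What remains is that the quantifier over open \<open>V\<close> distributes over
    the conjunction.\<close>
  by blast

end
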